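(* Consider the discretised A-optimal objective for multiple observations per sensor, $$\mathcal{J}(w):=\operatorname{tr}(\mathcal{C}_{\mathrm{post}}(w))=\operatorname{tr}\Big(\big(F^T\,\mathbf{Diag}(w)\,F+I\big)^{-1}M^{1/2}\mathcal{C}_0M^{-1/2}\Big),\qquad F:=\Gamma^{-1/2}\mathcal{F}\,\mathcal{C}_0^{1/2}M^{-1/2}\in\mathbb{R}^{m\,m_{\mathrm{obs}}\times n},$$ with all objects as in the context. Let $\ell\in\mathbb{N}$ be such that $F^T=QR\in\mathbb{R}^{n\times m\,m_{\mathrm{obs}}}$, where $Q\in\mathbb{R}^{n\times\ell}$ is semi-orthogonal, that is, $Q^TQ=I_\ell$, and $R\in\mathbb{R}^{\ell\times m\,m_{\mathrm{obs}}}$. Write $$L_w:=R\,\mathbf{Diag}(w)R^T+I_\ell\in\mathbb{R}^{\ell\times\ell},\qquad C:=Q^TM^{1/2}\mathcal{C}_0M^{-1/2}Q\in\mathbb{R}^{\ell\times\ell},$$ the latter being independent of $w$ and being decomposed as $C=(C^{1/2})^TC^{1/2}$. Then, given data $g\in\mathbb{R}^{m\,m_{\mathrm{obs}}}$, a prior mean $m_0\in\mathbb{R}^n$ and a prior covariance $\mathcal{C}_0\in\mathbb{R}^{n\times n}$, the posterior distribution $\mathcal{N}(m_{\mathrm{post}}(w),\mathcal{C}_{\mathrm{post}}(w))$ satisfies $$m_{\mathrm{post}}(w)=\mathcal{C}_0^{1/2}M^{-1/2}QL_w^{-1}R\,\Gamma^{-1/2}g+\mathcal{C}_{\mathrm{post}}(w)\mathcal{C}_0^{-1}m_0,$$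 $$\mathcal{C}_{\mathrm{post}}(w)=\mathcal{C}_0^{1/2}M^{-1/2}\big(I-QQ^T+QL_w^{-1}Q^T\big)M^{1/2}\mathcal{C}_0^{1/2},$$ and in a neighbourhood of $[0,1]^m$ the objective functional $\mathcal{J}$, its gradient and its Hessian matrix satisfy $$\mathcal{J}(w)=\operatorname{tr}(\mathcal{C}_0)-\operatorname{tr}(C)+\operatorname{tr}(L_w^{-1}C)\in\mathbb{R},$$ $$\nabla\mathcal{J}(w)=S\Big(\big(-\big|C^{1/2}L_w^{-1}Re_k\big|^2\big)_{k=1}^{m\,m_{\mathrm{obs}}}\Big)\in\mathbb{R}^m,$$ $$H_{\mathcal{J}}(w)=\sum_{k=1}^{m_{\mathrm{obs}}}\sum_{l=1}^{m_{\mathrm{obs}}}2\big[(R^{[k]})^TL_w^{-1}CL_w^{-1}R^{[l]}\big]\odot\big[(R^{[k]})^TL_w^{-1}R^{[l]}\big]\in\mathbb{R}^{m\times m}.$$ Here $\odot$ is the Schur (elementwise) matrix product, $e_k\in\mathbb{R}^{m\,m_{\mathrm{obs}}}$ is the $k$-th unit vector, $R^{[k]}:=(R_{i,j+(k-1)m})_{1\le i\le\ell,\,1\le j\le m}\in\mathbb{R}^{\ell\times m}$ is the $k$-th slice of the columns of $R$ for each $1\le k\le m_{\mathrm{obs}}$, and $S:\mathbb{R}^{m\,m_{\mathrm{obs}}}\to\mathbb{R}^m$ is the operation that sums each $m$-th element, $(Sv)_k:=\sum_{l=1}^{m_{\mathrm{obs}}}v_{k+m(l-1)}$ for each $1\le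 k\le m$.
   Context: $m,n,m_{\mathrm{obs}}\in\mathbb{N}$. $\operatorname{Diag}(w)\in\mathbb{R}^{m\times m}$ is the diagonal matrix with $w\in\mathbb{R}^m$ on its diagonal, and $\mathbf{Diag}(w)\in\mathbb{R}^{m\,m_{\mathrm{obs}}\times m\,m_{\mathrm{obs}}}$ is the block diagonal matrix with $m_{\mathrm{obs}}$ diagonal blocks all equal to $\operatorname{Diag}(w)$. $I$ is the $n\times n$ and $I_\ell$ the $\ell\times\ell$ identity matrix; $|\cdot|$ is the Euclidean norm. Discretised Bayesian setting. Let $\Omega\subseteq\mathbb{R}^d$ be a compact domain. The undiscretised prior covariance on $L^2(\Omega)$ is of the form $\mathfrak{K}^{-2}$, two applications of a self-adjoint PDE solution operator, for a densely defined differential operator $\mathfrak{K}$ on $L^2(\Omega)$. Let $(\phi_i)_{i=1}^n\subset L^2(\Omega)\cap\operatorname{dom}(\mathfrak{K})$ be linearly independent Lagrange basis functions, and let $M,\mathbf{K}\in\mathbb{R}^{n\times n}$ be the mass and stiffness matrices, $M_{ij}=\int_\Omega\phi_i\phi_j\,dx$ and $\mathbf{K}_{ij}=\int_\Omega\phi_i\mathfrak{K}\phi_j\,dx$. Let $M=(M^{1/2})^TM^{1/2}$ be a decomposition of $M$ with $M^{1/2}\in\mathbb{R}^{n\times n}$, and $M^{-1/2}:=(M^{1/2})^{-1}$. $\mathbb{R}^n_M$ denotes $\mathbb{R}^n$ with inner product $(a,a')_M:=a^TMa'$. The discretised prior covariance is $\mathcal{C}_0=\mathcal{C}_0^{1/2}\mathcal{C}_0^{1/2}:=\mathbf{K}^{-1}M\mathbf{K}^{-1}M$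 on $\mathbb{R}^n_M$, with $\mathcal{C}_0^{1/2}=\mathbf{K}^{-1}M$. Each of $m$ candidate sensors returns $m_{\mathrm{obs}}$ scalar observations: the discretised parameter-to-multiple-observables map is the linear map $\mathcal{F}:\mathbb{R}^n_M\to\mathbb{R}^{m\,m_{\mathrm{obs}}}$ obtained by stacking linear maps $\mathcal{F}_1,\dots,\mathcal{F}_{m_{\mathrm{obs}}}:\mathbb{R}^n_M\to\mathbb{R}^m$, with adjoint $\mathcal{F}^*=M^{-1}\mathcal{F}^T$ ($\mathcal{F}^T$ the transpose of its matrix). A design $w$ (originally $w\in\{0,1\}^m$, $w_k=1$ meaning that the $k$-th sensor is placed; relaxed to $w\in[0,1]^m$ for optimisation) enters through $\mathcal{F}_w:=\mathbf{Diag}(w)\mathcal{F}$. Data are modelled as $g=\mathcal{F}_wf+\epsilon\in\mathbb{R}^{m\,m_{\mathrm{obs}}}$ with unknown $f$ and Gaussian noise $\epsilon\sim\mathcal{N}(0,\Gamma)$, where $\Gamma\in\mathbb{R}^{m\,m_{\mathrm{obs}}\times m\,m_{\mathrm{obs}}}$ is diagonal with strictly positive diagonal entries. Given data $g$ and prior $\mathcal{N}(m_0,\mathcal{C}_0)$, the posterior distribution of $f$ is $\mathcal{N}(m_{\mathrm{post}}(w),\mathcal{C}_{\mathrm{post}}(w))$ with $$m_{\mathrm{post}}(w)=m_0+\mathcal{C}_{\mathrm{post}}(w)\mathcal{F}_w^*\Gamma^{-1}(g-\mathcal{F}_wm_0),\qquad \mathcal{C}_{\mathrm{post}}(w)=\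big(\mathcal{F}^*\Gamma^{-1/2}\,\mathbf{Diag}(w)\,\Gamma^{-1/2}\mathcal{F}+\mathcal{C}_0^{-1}\big)^{-1}.$$
   Formalization: The printed formula for m_post(w) fails in general (w=0 gives m_0); it is proved for w in {0,1}^m with Diag(w)g=g, and for every w near [0,1]^m with g replaced by Diag(w)(g+(I-Diag(w))F m_0), F the forward map; l≥1 is assumed. *)

theory Defs
  imports "HOL-Analysis.Analysis"
begin

text \<open>
  Square-integrable functions and operators on \<open>L\<^sup>2(\<Omega>)\<close>. Elements of \<open>L\<^sup>2(\<Omega>)\<close> are handled through
  representatives, i.e. functions modulo equality almost everywhere on \<open>\<Omega>\<close>.
\<close>

definition L2 :: "(real^'d) set \<Rightarrow> (real^'d \<Rightarrow> real) set" where
  "L2 \<Omega> = {u \<in> borel_measurable (lebesgue_on \<Omega>). integrable (lebesgue_on \<Omega>) (\<lambda>x. (u x)\<^sup>2)}"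

definition l2_inner :: "(real^'d) set \<Rightarrow> (real^'d \<Rightarrow> real) \<Rightarrow> (real^'d \<Rightarrow> real) \<Rightarrow> real" where
  "l2_inner \<Omega> u v = (LINT x|lebesgue_on \<Omega>. u x * v x)"

definition ae_eq :: "(real^'d) set \<Rightarrow> (real^'d \<Rightarrow> real) \<Rightarrow> (real^'d \<Rightarrow> real) \<Rightarrow> bool" where
  "ae_eq \<Omega> u v \<longleftrightarrow> (AE x in lebesgue_on \<Omega>. u x = v x)"

text \<open>
  A linear operator \<open>A\<close> on \<open>L\<^sup>2(\<Omega>)\<close> with domain \<open>D\<close>; the last clause says that \<open>D\<close> and \<open>A\<close> descend
  to equivalence classes.
\<close>

definition L2_operator ::
    "(real^'d) set \<Rightarrow> (real^'d \<Rightarrow> real) set \<Rightarrow> ((real^'d \<Rightarrow> real) \<Rightarrow> (real^'d \<Rightarrow> real)) \<Rightarrow> bool" where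
  "L2_operator \<Omega> D A \<longleftrightarrow>
     D \<subseteq> L2 \<Omega> \<and> (\<lambda>_. 0) \<in> D \<and>
     (\<forall>u\<in>D. \<forall>v\<in>D. \<forall>a b. (\<lambda>x. a * u x + b * v x) \<in> D) \<and>
     (\<forall>u\<in>D. A u \<in> L2 \<Omega>) \<and>
     (\<forall>u\<in>D. \<forall>v\<in>D. \<forall>a b. ae_eq \<Omega> (A (\<lambda>x. a * u x + b * v x)) (\<lambda>x. a * A u x + b * A v x)) \<and>
     (\<forall>u\<in>D. \<forall>v\<in>L2 \<Omega>. ae_eq \<Omega> u v \<longrightarrow> v \<in> D \<and> ae_eq \<Omega> (A u) (A v))"

definition densely_defined :: "(real^'d) set \<Rightarrow> (real^'d \<Rightarrow> real) set \<Rightarrow> bool" where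
  "densely_defined \<Omega> D \<longleftrightarrow>
     (\<forall>u\<in>L2 \<Omega>. \<forall>\<epsilon>>0. \<exists>v\<in>D. sqrt (l2_inner \<Omega> (\<lambda>x. u x - v x) (\<lambda>x. u x - v x)) < \<epsilon>)"

text \<open>
  The operator \<open>A\<close> is boundedly invertible with self-adjoint inverse \<open>G\<close>, the solution operator of
  \<open>A u = f\<close>. As \<open>G\<close> is defined on all of \<open>L\<^sup>2(\<Omega>)\<close>, symmetry is self-adjointness, and it implies
  boundedness (Hellinger--Toeplitz).
\<close>

definition selfadjoint_solution_operator ::
    "(real^'d) set \<Rightarrow> (real^'d \<Rightarrow> real) set \<Rightarrow> ((real^'d \<Rightarrow> real) \<Rightarrow> (real^'d \<Rightarrow> real)) \<Rightarrow>
     ((real^'d \<Rightarrow> real) \<Rightarrow> (real^'d \<Rightarrow> real)) \<Rightarrow> bool" where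
  "selfadjoint_solution_operator \<Omega> D A G \<longleftrightarrow>
     L2_operator \<Omega> (L2 \<Omega>) G \<and>
     (\<forall>f\<in>L2 \<Omega>. G f \<in> D \<and> ae_eq \<Omega> (A (G f)) f) \<and>
     (\<forall>u\<in>D. ae_eq \<Omega> (G (A u)) u) \<and>
     (\<forall>f\<in>L2 \<Omega>. \<forall>h\<in>L2 \<Omega>. l2_inner \<Omega> (G f) h = l2_inner \<Omega> f (G h))"

definition L2_independent :: "(real^'d) set \<Rightarrow> ('n::finite \<Rightarrow> real^'d \<Rightarrow> real) \<Rightarrow> bool" where
  "L2_independent \<Omega> \<phi> \<longleftrightarrow>
     (\<forall>c. ae_eq \<Omega> (\<lambda>x. \<Sum>i\<in>UNIV. c i * \<phi> i x) (\<lambda>_. 0) \<longrightarrow> (\<forall>i. c i = 0))"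

definition lagrange_basis ::
    "(real^'d) set \<Rightarrow> ('n \<Rightarrow> real^'d) \<Rightarrow> ('n \<Rightarrow> real^'d \<Rightarrow> real) \<Rightarrow> bool" where
  "lagrange_basis \<Omega> node \<phi> \<longleftrightarrow>
     (\<forall>i. node i \<in> \<Omega>) \<and> (\<forall>i j. \<phi> i (node j) = (if i = j then 1 else 0))"

definition mass_matrix :: "(real^'d) set \<Rightarrow> ('n::finite \<Rightarrow> real^'d \<Rightarrow> real) \<Rightarrow> real^'n^'n" where
  "mass_matrix \<Omega> \<phi> = (\<chi> i j. l2_inner \<Omega> (\<phi> i) (\<phi> j))"

definition stiffness_matrix ::
    "(real^'d) set \<Rightarrow> ((real^'d \<Rightarrow> real) \<Rightarrow> (real^'d \<Rightarrow> real)) \<Rightarrow> ('n::finite \<Rightarrow> real^'d \<Rightarrow> real) \<Rightarrow> real^'n^'n" where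
  "stiffness_matrix \<Omega> A \<phi> = (\<chi> i j. l2_inner \<Omega> (\<phi> i) (A (\<phi> j)))"

text \<open>
  The space of all \<open>m m\<^sub>o\<^sub>b\<^sub>s\<close> observations is \<open>real^('o \<times> 'm)\<close> with \<open>CARD('m)\<close> sensors and
  \<open>CARD('o)\<close> observations per sensor: the pair \<open>(l, k)\<close> stands for the flat index \<open>k + (l - 1) m\<close>,
  so the first component numbers the blocks of length \<open>m\<close>.
\<close>

definition Diag :: "real^'k \<Rightarrow> real^'k^'k" where
  "Diag v = (\<chi> i j. if i = j then v $ i else 0)"

definition BDiag :: "real^'m \<Rightarrow> real^('o::finite \<times> 'm::finite)^('o \<times> 'm)" where
  "BDiag w = (\<chi> p q. if fst p = fst q then Diag w $ snd p $ snd q else 0)"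

definition stack :: "('o::finite \<Rightarrow> real^'n^'m) \<Rightarrow> real^'n^('o \<times> 'm::finite)" where
  "stack A = (\<chi> p. A (fst p) $ snd p)"

definition slice :: "real^('o::finite \<times> 'm::finite)^'l \<Rightarrow> 'o \<Rightarrow> real^'m^'l" where
  "slice R k = (\<chi> i j. R $ i $ (k, j))"

definition block_sum :: "real^('o::finite \<times> 'm::finite) \<Rightarrow> real^'m" where
  "block_sum v = (\<chi> k. \<Sum>l\<in>UNIV. v $ (l, k))"

definition schur_product :: "real^'a^'b \<Rightarrow> real^'a^'b \<Rightarrow> real^'a^'b"  (infixl "\<odot>" 70) where
  "A \<odot> B = (\<chi> i j. A $ i $ j * B $ i $ j)"

text \<open>The power \<open>\<Gamma>\<^sup>-\<^sup>1\<^sup>/\<^sup>2\<close> of a diagonal matrix \<open>\<Gamma>\<close> with positive diagonal.\<close>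

definition diag_inv_sqrt :: "real^'k^'k \<Rightarrow> real^'k^'k" where
  "diag_inv_sqrt \<Gamma> = Diag (\<chi> i. 1 / sqrt (\<Gamma> $ i $ i))"

definition prior_cov_sqrt :: "real^'n^'n \<Rightarrow> real^'n^'n \<Rightarrow> real^'n^'n" where
  "prior_cov_sqrt M K = matrix_inv K ** M"

definition prior_cov :: "real^'n^'n \<Rightarrow> real^'n^'n \<Rightarrow> real^'n^'n" where
  "prior_cov M K = prior_cov_sqrt M K ** prior_cov_sqrt M K"

text \<open>
  The adjoint of a matrix as a map from \<open>\<real>\<^sup>n\<close> with inner product \<open>(a, b)\<^sub>M = a\<^sup>T M b\<close> to a standard
  Euclidean space.
\<close>

definition M_adjoint :: "real^'n^'n \<Rightarrow> real^'n^'k \<Rightarrow> real^'k^'n" where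
  "M_adjoint M A = matrix_inv M ** transpose A"

definition post_precision ::
    "real^'n^'n \<Rightarrow> real^'n^'n \<Rightarrow> real^'n^('o::finite \<times> 'm::finite) \<Rightarrow> real^('o \<times> 'm)^('o \<times> 'm) \<Rightarrow>
     real^'m \<Rightarrow> real^'n^'n" where
  "post_precision M K Fo \<Gamma> w =
     M_adjoint M Fo ** diag_inv_sqrt \<Gamma> ** BDiag w ** diag_inv_sqrt \<Gamma> ** Fo
       + matrix_inv (prior_cov M K)"

definition post_cov ::
    "real^'n^'n \<Rightarrow> real^'n^'n \<Rightarrow> real^'n^('o::finite \<times> 'm::finite) \<Rightarrow> real^('o \<times> 'm)^('o \<times> 'm) \<Rightarrow>
     real^'m \<Rightarrow> real^'n^'n" where
  "post_cov M K Fo \<Gamma> w = matrix_inv (post_precision M K Fo \<Gamma> w)"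

text \<open>
  The precision contains \<open>Diag(w)\<close> to the first power, whereas the forward map
  \<open>F\<^sub>w = Diag(w) F\<close> entering the mean contributes \<open>Diag(w)\<^sup>2\<close> to \<open>F\<^sub>w\<^sup>* \<Gamma>\<^sup>-\<^sup>1 F\<^sub>w\<close>. The two agree for
  designs with entries in \<open>{0, 1}\<close>, but not for relaxed designs.
\<close>

definition post_mean ::
    "real^'n^'n \<Rightarrow> real^'n^'n \<Rightarrow> real^'n^('o::finite \<times> 'm::finite) \<Rightarrow> real^('o \<times> 'm)^('o \<times> 'm) \<Rightarrow>
     real^('o \<times> 'm) \<Rightarrow> real^'n \<Rightarrow> real^'m \<Rightarrow> real^'n" where
  "post_mean M K Fo \<Gamma> g m0 w =
     m0 + (post_cov M K Fo \<Gamma> w ** M_adjoint M (BDiag w ** Fo) ** matrix_inv \<Gamma>)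
            *v (g - (BDiag w ** Fo) *v m0)"

text \<open>\<open>f\<close> is differentiable near \<open>x\<close> and \<open>H\<close> is the Jacobian matrix at \<open>x\<close> of its gradient.\<close>

definition has_hessian :: "(real^'m \<Rightarrow> real) \<Rightarrow> real^'m^'m \<Rightarrow> real^'m \<Rightarrow> bool" where
  "has_hessian f H x \<longleftrightarrow>
     (\<exists>G. (\<forall>\<^sub>F y in nhds x. GDERIV f y :> G y) \<and> (G has_derivative (\<lambda>h. H *v h)) (at x))"

end

theory Submission
  imports Defs
begin

text \<open>
  Changing variables by the square root of the prior covariance turns the
  posterior precision into \<open>N = F\<^sup>T D F + I\<close> with \<open>D = BDiag w\<close>: the precision equals
  \<open>V N U\<close> with \<open>V = M\<^sup>-\<^sup>1 K Mh\<^sup>-\<^sup>1\<close> and \<open>U = Mh M\<^sup>-\<^sup>1 K\<close>, both invertible and independent of the design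
  (\<open>post_precision_whitened\<close>). This uses that \<open>K\<close> is symmetric, which is inherited from the
  self-adjointness of the solution operator, and that \<open>M\<close> is invertible, which is the linear
  independence of the basis.

  Since \<open>F\<^sup>T = Q R\<close>, the matrix \<open>N = Q (R D R\<^sup>T) Q\<^sup>T + I\<close> differs from the identity only on the
  range of \<open>Q\<close>, where it acts as \<open>L = R D R\<^sup>T + I\<close>. Semi-orthogonality of \<open>Q\<close> makes
  \<open>I - Q Q\<^sup>T\<close> the projection onto the complement of this range, so
  \<open>N\<^sup>-\<^sup>1 = I - Q Q\<^sup>T + Q L\<^sup>-\<^sup>1 Q\<^sup>T\<close> (\<open>right_inverse_semi_orthogonal_update\<close>). The formulas for the
  posterior covariance, the posterior mean and the objective follow by algebra and the cyclic
  invariance of the trace.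

  After this reduction the design enters the objective only through \<open>tr(L\<^sup>-\<^sup>1 C)\<close>, where \<open>L\<close> is
  affine in \<open>w\<close>. The derivative of matrix inversion at \<open>A\<close> in direction \<open>H\<close> is
  \<open>- A\<^sup>-\<^sup>1 H A\<^sup>-\<^sup>1\<close> (\<open>has_derivative_matrix_inv\<close>); applying it once gives the gradient, whose entries are
  sums of diagonal entries of \<open>R\<^sup>T L\<^sup>-\<^sup>1 C L\<^sup>-\<^sup>1 R\<close>, and applying it again together with the product rule
  gives the Hessian. All of this is valid on the open set where \<open>det L\<close> does not vanish. It contains
  the cube because \<open>L\<close> is the identity plus a positive semidefinite matrix for nonnegative weights.
\<close>

section \<open>Matrix inversion and its derivative\<close>

lemma matrix_inv_mult_cancel:
  assumes "invertible A"
  shows "A ** matrix_inv A = mat 1" "matrix_inv A ** A = mat 1"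
proof -
  have "A ** matrix_inv A = mat 1 \<and> matrix_inv A ** A = mat 1"
    using assms unfolding invertible_def matrix_inv_def by (rule someI_ex)
  then show "A ** matrix_inv A = mat 1" "matrix_inv A ** A = mat 1" by auto
qed

lemma matrix_inv_eqI:
  fixes A B :: "real^'n^'n"
  assumes "A ** B = mat 1"
  shows "invertible A" "matrix_inv A = B"
proof -
  show inv: "invertible A"
    using assms matrix_left_right_inverse[of A B] unfolding invertible_def by blast
  have "matrix_inv A = matrix_inv A ** (A ** B)" by (simp add: assms)
  also have "\<dots> = B" by (simp add: matrix_mul_assoc matrix_inv_mult_cancel[OF inv])
  finally show "matrix_inv A = B" .
qed

lemma transpose_matrix_inv:
  fixes A :: "real^'n^'n"
  assumes "invertible A"
  shows "transpose (matrix_inv A) = matrix_inv (transpose A)"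
proof -
  have "transpose A ** transpose (matrix_inv A) = transpose (matrix_inv A ** A)"
    by (simp only: matrix_transpose_mul)
  then have "transpose A ** transpose (matrix_inv A) = mat 1"
    by (simp add: matrix_inv_mult_cancel(2)[OF assms] transpose_mat)
  then show ?thesis by (rule matrix_inv_eqI(2)[symmetric])
qed

lemma bounded_bilinear_matrix_mult:
  "bounded_bilinear ((**) :: real^'n^'m \<Rightarrow> real^'k^'n \<Rightarrow> real^'k^'m)"
proof -
  have "bilinear ((**) :: real^'n^'m \<Rightarrow> real^'k^'n \<Rightarrow> real^'k^'m)"
    unfolding bilinear_def
    by (auto intro!: linearI
        simp: vec_eq_iff matrix_matrix_mult_def sum.distrib sum_distrib_left algebra_simps)
  then show ?thesis by (simp add: bilinear_conv_bounded_bilinear)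
qed

interpretation matrix_mult: bounded_bilinear "(**) :: real^'n^'m \<Rightarrow> real^'k^'n \<Rightarrow> real^'k^'m"
  by (rule bounded_bilinear_matrix_mult)

lemma transpose_matrix_add: "transpose (A + B) = transpose A + transpose (B :: real^'n^'m)"
  by (simp add: vec_eq_iff transpose_def)

lemma bounded_linear_trace: "bounded_linear (trace :: real^'n^'n \<Rightarrow> real)"
  unfolding linear_conv_bounded_linear[symmetric]
  by (auto intro!: linearI simp: trace_def sum.distrib sum_distrib_left)

lemma continuous_on_det: "continuous_on S (det :: real^'n^'n \<Rightarrow> real)"
  unfolding det_def by (intro continuous_intros)

text \<open>
  Cramer's rule writes the entries of the inverse as quotients of determinants, which exhibits
  continuity of inversion without any norm estimate for inverses.
\<close>

lemma matrix_inv_component: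
  fixes A :: "real^'n^'n"
  assumes "det A \<noteq> 0"
  shows "matrix_inv A $ k $ l = det (\<chi> i j. if j = k then (if i = l then 1 else 0) else A $ i $ j) / det A"
proof -
  have inv: "invertible A" using assms by (simp add: invertible_det_nz)
  have "A *v (matrix_inv A *v axis l 1) = axis l 1"
    by (simp add: matrix_vector_mul_assoc matrix_inv_mult_cancel[OF inv])
  then have "matrix_inv A *v axis l 1
      = (\<chi> k. det (\<chi> i j. if j = k then axis l 1 $ i else A $ i $ j) / det A)"
    using cramer[OF assms] by blast
  moreover have "(matrix_inv A *v axis l 1) $ k = matrix_inv A $ k $ l"
    by (simp add: matrix_vector_mult_basis column_def)
  ultimately show ?thesis by (simp add: axis_def eq_commute cong: if_cong)
qed

lemma isCont_matrix_inv:
  fixes A :: "real^'n^'n"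
  assumes "invertible A"
  shows "isCont matrix_inv A"
proof -
  let ?S = "{B :: real^'n^'n. det B \<noteq> 0}"
  have open_S: "open ?S"
    by (rule open_Collect_neq) (auto intro: continuous_on_det)
  have "continuous_on ?S
      (\<lambda>B. \<chi> k l. det (\<chi> i j. if j = k then (if i = l then 1 else 0) else B $ i $ j) / det B)"
  proof (intro continuous_on_vec_lambda continuous_on_divide)
    fix k l :: 'n
    have "continuous_on ?S (\<lambda>B. (\<chi> i j. if j = k then (if i = l then 1 else 0) else B $ i $ j) :: real^'n^'n)"
    proof (intro continuous_on_vec_lambda)
      fix i j
      show "continuous_on ?S (\<lambda>B. if j = k then (if i = l then 1 else 0) else B $ i $ j)"
        by (cases "j = k") (auto intro!: continuous_intros)
    qed
    then show "continuous_on ?S (\<lambda>B. det (\<chi> i j. if j = k then (if i = l then 1 else 0) else B $ i $ j))"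
      by (rule continuous_on_compose2[OF continuous_on_det[of UNIV]]) simp
  qed (auto intro: continuous_on_det)
  then have "continuous_on ?S matrix_inv"
    by (rule continuous_on_eq) (auto simp: vec_eq_iff matrix_inv_component)
  then show ?thesis
    using assms by (simp add: continuous_on_eq_continuous_at[OF open_S] invertible_det_nz)
qed

text \<open>
  The resolvent identity \<open>B\<^sup>-\<^sup>1 - A\<^sup>-\<^sup>1 = - B\<^sup>-\<^sup>1 (B - A) A\<^sup>-\<^sup>1\<close> shows that the remainder of the linear
  approximation is \<open>- (B\<^sup>-\<^sup>1 - A\<^sup>-\<^sup>1) (B - A) A\<^sup>-\<^sup>1\<close>, which is \<open>o(B - A)\<close> because inversion is
  continuous.
\<close>

lemma has_derivative_matrix_inv_at:
  fixes A :: "real^'n^'n"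
  assumes "invertible A"
  shows "(matrix_inv has_derivative (\<lambda>H. - (matrix_inv A ** H ** matrix_inv A))) (at A)"
proof (rule has_derivativeI)
  let ?X = "matrix_inv A"
  have bl: "bounded_linear (\<lambda>H. ?X ** H ** ?X)"
    by (rule bounded_linear_compose[OF matrix_mult.bounded_linear_left matrix_mult.bounded_linear_right])
  show "bounded_linear (\<lambda>H. - (?X ** H ** ?X))" by (rule bounded_linear_minus[OF bl])
  obtain c where c: "0 \<le> c" "\<And>(Y :: real^'n^'n) (Z :: real^'n^'n). norm (Y ** Z) \<le> norm Y * norm Z * c"
    using matrix_mult.nonneg_bounded by blast
  have ev: "\<forall>\<^sub>F B in at A. invertible B"
  proof -
    have "open {B :: real^'n^'n. det B \<noteq> 0}"
      by (rule open_Collect_neq) (auto intro: continuous_on_det)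
    then have "\<forall>\<^sub>F B in nhds A. B \<in> {B. det B \<noteq> 0}"
      using assms by (intro eventually_nhds_in_open) (auto simp: invertible_det_nz)
    then show ?thesis by (auto simp: invertible_det_nz eventually_nhds_conv_at)
  qed
  have lim: "((\<lambda>B. norm (matrix_inv B - ?X) * (c * c * norm ?X)) \<longlongrightarrow> 0) (at A)"
    using isCont_matrix_inv[OF assms] unfolding isCont_def
    by (auto intro!: tendsto_mult_left_zero tendsto_norm_zero simp: LIM_zero)
  show "((\<lambda>B. (matrix_inv B - ?X - - (?X ** (B - A) ** ?X)) /\<^sub>R norm (B - A)) \<longlongrightarrow> 0) (at A)"
  proof (rule Lim_null_comparison[OF _ lim])
    show "\<forall>\<^sub>F B in at A. norm ((matrix_inv B - ?X - - (?X ** (B - A) ** ?X)) /\<^sub>R norm (B - A))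
        \<le> norm (matrix_inv B - ?X) * (c * c * norm ?X)"
      using ev
    proof eventually_elim
      case (elim B)
      have "matrix_inv B - ?X = - (matrix_inv B ** (B - A) ** ?X)"
        by (simp add: matrix_mult.diff_left matrix_mult.diff_right matrix_inv_mult_cancel elim
            matrix_mul_assoc[symmetric] assms) 
      moreover have "(matrix_inv B - ?X) ** (B - A) ** ?X
          = matrix_inv B ** (B - A) ** ?X - ?X ** (B - A) ** ?X"
        by (simp only: matrix_mult.diff_left)
      ultimately have "matrix_inv B - ?X - - (?X ** (B - A) ** ?X)
          = - ((matrix_inv B - ?X) ** (B - A) ** ?X)"
        by (simp only:) simp
      then have "norm (matrix_inv B - ?X - - (?X ** (B - A) ** ?X))
          = norm ((matrix_inv B - ?X) ** (B - A) ** ?X)" by simp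
      also have "\<dots> \<le> norm (matrix_inv B - ?X) * norm (B - A) * c * norm ?X * c"
        using c(2)[of "(matrix_inv B - ?X) ** (B - A)" ?X]
          mult_right_mono[OF mult_right_mono[OF c(2)[of "matrix_inv B - ?X" "B - A"] norm_ge_zero[of ?X]] c(1)]
        by linarith
      finally have le: "norm (matrix_inv B - ?X - - (?X ** (B - A) ** ?X))
          \<le> norm (matrix_inv B - ?X) * (c * c * norm ?X) * norm (B - A)"
        by (simp only: mult_ac)
      show ?case
      proof (cases "B = A")
        case False
        then show ?thesis
          using le by (simp only: norm_scaleR abs_inverse abs_norm_cancel mult.commute[of "inverse _"]
              divide_inverse[symmetric] pos_divide_le_eq zero_less_norm_iff
              right_minus_eq not_False_eq_True)
      qed (simp add: c)
    qed
  qed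
qed

lemma has_derivative_matrix_inv:
  fixes A :: "'a::real_normed_vector \<Rightarrow> real^'n^'n"
  assumes "(A has_derivative A') (at x within S)" "invertible (A x)"
  shows "((\<lambda>y. matrix_inv (A y)) has_derivative
      (\<lambda>h. - (matrix_inv (A x) ** A' h ** matrix_inv (A x)))) (at x within S)"
  using has_derivative_compose[OF assms(1) has_derivative_matrix_inv_at[OF assms(2)]] .

section \<open>Diagonal design matrices\<close>

lemma BDiag_eq_Diag: "BDiag w = Diag (\<chi> p. w $ snd p)"
  by (auto simp: vec_eq_iff BDiag_def Diag_def prod_eq_iff)

lemma Diag_mult_vec: "Diag v *v x = (\<chi> i. v $ i * x $ i)"
  by (simp add: vec_eq_iff Diag_def matrix_vector_mult_def if_distrib[of "\<lambda>a. a * _"] cong: if_cong)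

lemma Diag_mult_component: "(Diag v ** A) $ i $ j = v $ i * A $ i $ j"
  by (simp add: Diag_def matrix_matrix_mult_def if_distrib[of "\<lambda>a. a * _"] cong: if_cong)

lemma mult_Diag_component: "(A ** Diag v) $ i $ j = A $ i $ j * v $ j"
  by (simp add: Diag_def matrix_matrix_mult_def if_distrib[of "\<lambda>a. _ * a"] cong: if_cong)

lemma Diag_mult_Diag: "Diag u ** Diag v = Diag (\<chi> i. u $ i * v $ i)"
  by (simp add: vec_eq_iff Diag_mult_component) (simp add: Diag_def)

lemma Diag_commute: "Diag u ** Diag v = Diag v ** Diag u"
  by (simp add: Diag_mult_Diag mult.commute)

lemma transpose_Diag [simp]: "transpose (Diag v) = Diag v"
  by (auto simp: vec_eq_iff Diag_def transpose_def)

lemma trace_Diag_mult: "trace (Diag v ** A) = (\<Sum>i\<in>UNIV. v $ i * A $ i $ i)"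
  by (simp add: trace_def Diag_mult_component)

lemma bounded_linear_BDiag:
  "bounded_linear (BDiag :: real^'m \<Rightarrow> real^('o::finite \<times> 'm)^('o \<times> 'm::finite))"
  unfolding linear_conv_bounded_linear[symmetric]
  by (auto intro!: linearI simp: vec_eq_iff BDiag_eq_Diag Diag_def)

lemma BDiag_binary_idem:
  assumes "\<And>k. w $ k \<in> {0, 1}"
  shows "BDiag w *v (BDiag w *v x) = BDiag w *v x"
proof -
  have "w $ k * (w $ k * a) = w $ k * a" for k a using assms[of k] by auto
  then show ?thesis by (simp only: BDiag_eq_Diag Diag_mult_vec vec_lambda_beta)
qed

lemma diag_inv_sqrt_squared:
  fixes \<Gamma> :: "real^'k^'k"
  assumes "\<And>p q. p \<noteq> q \<Longrightarrow> \<Gamma> $ p $ q = 0" "\<And>p. 0 < \<Gamma> $ p $ p"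
  shows "matrix_inv \<Gamma> = diag_inv_sqrt \<Gamma> ** diag_inv_sqrt \<Gamma>"
proof (rule matrix_inv_eqI)
  have \<Gamma>: "\<Gamma> = Diag (\<chi> p. \<Gamma> $ p $ p)"
    using assms(1) by (auto simp: vec_eq_iff Diag_def)
  have "\<Gamma> $ p $ p * (1 / sqrt (\<Gamma> $ p $ p) * (1 / sqrt (\<Gamma> $ p $ p))) = 1" for p
    using assms(2)[of p] by (simp add: field_simps)
  then show "\<Gamma> ** (diag_inv_sqrt \<Gamma> ** diag_inv_sqrt \<Gamma>) = mat 1"
    by (subst \<Gamma>) (simp add: diag_inv_sqrt_def Diag_mult_Diag, simp add: vec_eq_iff Diag_def mat_def)
qed

section \<open>Stiffness and mass matrix\<close>

lemma square_integrable_mult: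
  fixes u v :: "real^'d \<Rightarrow> real"
  assumes "u \<in> L2 \<Omega>" "v \<in> L2 \<Omega>"
  shows "integrable (lebesgue_on \<Omega>) (\<lambda>x. u x * v x)"
proof (rule Bochner_Integration.integrable_bound)
  show "integrable (lebesgue_on \<Omega>) (\<lambda>x. (u x)\<^sup>2 + (v x)\<^sup>2)"
    using assms by (simp add: L2_def)
  show "(\<lambda>x. u x * v x) \<in> borel_measurable (lebesgue_on \<Omega>)"
    using assms by (auto simp: L2_def intro: borel_measurable_times)
  have "\<bar>a * b\<bar> \<le> a\<^sup>2 + b\<^sup>2" for a b :: real
    using sum_squares_bound[of "\<bar>a\<bar>" "\<bar>b\<bar>"] mult_nonneg_nonneg[OF abs_ge_zero abs_ge_zero, of a b]
    unfolding abs_mult power2_abs by linarith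
  then show "AE x in lebesgue_on \<Omega>. norm (u x * v x) \<le> norm ((u x)\<^sup>2 + (v x)\<^sup>2)" by simp
qed

lemma l2_inner_commute: "l2_inner \<Omega> u v = l2_inner \<Omega> v u"
  by (simp add: l2_inner_def mult.commute)

lemma l2_inner_cong_ae_left:
  assumes "ae_eq \<Omega> u u'" "u \<in> L2 \<Omega>" "u' \<in> L2 \<Omega>" "v \<in> L2 \<Omega>"
  shows "l2_inner \<Omega> u v = l2_inner \<Omega> u' v"
  unfolding l2_inner_def
proof (rule integral_cong_AE)
  show "AE x in lebesgue_on \<Omega>. u x * v x = u' x * v x"
    using assms(1) by (auto simp: ae_eq_def)
qed (use assms in \<open>auto simp: L2_def intro!: borel_measurable_times\<close>)

text \<open>
  Every basis function \<open>\<phi> i\<close> agrees almost everywhere with \<open>G (A (\<phi> i))\<close>. Writing it in this form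
  expresses the entries through the solution operator \<open>G\<close>, whose symmetry carries over.
\<close>

lemma stiffness_matrix_symmetric:
  fixes \<phi> :: "'n::finite \<Rightarrow> real^'d \<Rightarrow> real"
  assumes op: "L2_operator \<Omega> D A"
    and sol: "selfadjoint_solution_operator \<Omega> D A G"
    and \<phi>: "\<And>i. \<phi> i \<in> D"
  shows "transpose (stiffness_matrix \<Omega> A \<phi>) = stiffness_matrix \<Omega> A \<phi>"
proof -
  have L2: "\<phi> i \<in> L2 \<Omega>" "A (\<phi> i) \<in> L2 \<Omega>" for i
    using op \<phi> by (auto simp: L2_operator_def)
  have G_L2: "G (A (\<phi> i)) \<in> L2 \<Omega>" for i
    using sol L2 by (auto simp: selfadjoint_solution_operator_def L2_operator_def)
  have GA: "ae_eq \<Omega> (G (A (\<phi> i))) (\<phi> i)" for i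
    using sol \<phi> by (auto simp: selfadjoint_solution_operator_def)
  have "l2_inner \<Omega> (\<phi> i) (A (\<phi> j)) = l2_inner \<Omega> (\<phi> j) (A (\<phi> i))" for i j
  proof -
    have "l2_inner \<Omega> (\<phi> i) (A (\<phi> j)) = l2_inner \<Omega> (G (A (\<phi> i))) (A (\<phi> j))"
      by (rule l2_inner_cong_ae_left[symmetric]) (use GA L2 G_L2 in auto)
    also have "\<dots> = l2_inner \<Omega> (A (\<phi> i)) (G (A (\<phi> j)))"
      using sol L2 by (auto simp: selfadjoint_solution_operator_def)
    also have "\<dots> = l2_inner \<Omega> (G (A (\<phi> j))) (A (\<phi> i))" by (rule l2_inner_commute)
    also have "\<dots> = l2_inner \<Omega> (\<phi> j) (A (\<phi> i))"
      by (rule l2_inner_cong_ae_left) (use GA L2 G_L2 in auto)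
    finally show ?thesis .
  qed
  then show ?thesis by (simp add: vec_eq_iff transpose_def stiffness_matrix_def)
qed

lemma mass_matrix_quadratic_form:
  fixes \<phi> :: "'n::finite \<Rightarrow> real^'d \<Rightarrow> real"
  assumes "\<And>i. \<phi> i \<in> L2 \<Omega>"
  shows "integrable (lebesgue_on \<Omega>) (\<lambda>x. (\<Sum>i\<in>UNIV. c $ i * \<phi> i x)\<^sup>2)"
    and "c \<bullet> (mass_matrix \<Omega> \<phi> *v c) = (LINT x|lebesgue_on \<Omega>. (\<Sum>i\<in>UNIV. c $ i * \<phi> i x)\<^sup>2)"
proof -
  have square: "(\<Sum>i\<in>UNIV. c $ i * \<phi> i x)\<^sup>2
      = (\<Sum>i\<in>UNIV. \<Sum>j\<in>UNIV. c $ i * c $ j * (\<phi> i x * \<phi> j x))" for x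
    by (simp add: power2_eq_square sum_product mult_ac)
  have int: "integrable (lebesgue_on \<Omega>) (\<lambda>x. \<phi> i x * \<phi> j x)" for i j
    using assms by (intro square_integrable_mult) auto
  show "integrable (lebesgue_on \<Omega>) (\<lambda>x. (\<Sum>i\<in>UNIV. c $ i * \<phi> i x)\<^sup>2)"
    unfolding square by (intro Bochner_Integration.integrable_sum integrable_mult_right int)
  have "(LINT x|lebesgue_on \<Omega>. (\<Sum>i\<in>UNIV. c $ i * \<phi> i x)\<^sup>2)
      = (\<Sum>i\<in>UNIV. \<Sum>j\<in>UNIV. c $ i * c $ j * (LINT x|lebesgue_on \<Omega>. \<phi> i x * \<phi> j x))"
    unfolding square
    by (subst Bochner_Integration.integral_sum, intro Bochner_Integration.integrable_sum integrable_mult_right int)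
      (intro sum.cong refl, subst Bochner_Integration.integral_sum, auto intro: int)
  also have "\<dots> = c \<bullet> (mass_matrix \<Omega> \<phi> *v c)"
    by (simp add: inner_vec_def matrix_vector_mult_def mass_matrix_def l2_inner_def
        sum_distrib_left mult_ac)
  finally show "c \<bullet> (mass_matrix \<Omega> \<phi> *v c) = (LINT x|lebesgue_on \<Omega>. (\<Sum>i\<in>UNIV. c $ i * \<phi> i x)\<^sup>2)" ..
qed

lemma invertible_if_trivial_kernel:
  fixes A :: "real^'n^'n"
  assumes "\<And>x. A *v x = 0 \<Longrightarrow> x = 0"
  shows "invertible A"
  using assms by (simp add: invertible_left_inverse matrix_left_invertible_ker)

text \<open>
  A vector in the kernel is the coefficient vector of a combination of the basis with vanishing
  \<open>L\<^sup>2\<close> norm, and linear independence is understood modulo null sets.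
\<close>

lemma invertible_mass_matrix:
  fixes \<phi> :: "'n::finite \<Rightarrow> real^'d \<Rightarrow> real"
  assumes L2: "\<And>i. \<phi> i \<in> L2 \<Omega>" and indep: "L2_independent \<Omega> \<phi>"
  shows "invertible (mass_matrix \<Omega> \<phi>)"
proof (rule invertible_if_trivial_kernel)
  fix c assume "mass_matrix \<Omega> \<phi> *v c = 0"
  then have "(LINT x|lebesgue_on \<Omega>. (\<Sum>i\<in>UNIV. c $ i * \<phi> i x)\<^sup>2) = 0"
    using mass_matrix_quadratic_form(2)[of \<phi> \<Omega> c] L2 by simp
  then have "AE x in lebesgue_on \<Omega>. (\<Sum>i\<in>UNIV. c $ i * \<phi> i x)\<^sup>2 = 0"
    using integral_nonneg_eq_0_iff_AE[OF mass_matrix_quadratic_form(1)[of \<phi> \<Omega> c]] L2 by simp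
  then have "ae_eq \<Omega> (\<lambda>x. \<Sum>i\<in>UNIV. c $ i * \<phi> i x) (\<lambda>_. 0)"
    by (simp add: ae_eq_def)
  then show "c = 0"
    using indep by (auto simp: L2_independent_def vec_eq_iff)
qed

section \<open>Reduction to the range of a semi-orthogonal factor\<close>

text \<open>
  For nonnegative weights the quadratic form of the matrix dominates the squared norm, so its kernel
  is trivial.
\<close>

lemma invertible_reduced_precision:
  fixes R :: "real^('o::finite \<times> 'm::finite)^'l"
  assumes "\<And>k. 0 \<le> w $ k"
  shows "invertible (R ** BDiag w ** transpose R + mat 1)"
proof (rule invertible_if_trivial_kernel)
  fix x assume x: "(R ** BDiag w ** transpose R + mat 1) *v x = 0"
  let ?y = "transpose R *v x"
  have "0 \<le> ?y \<bullet> (BDiag w *v ?y)"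
    unfolding BDiag_eq_Diag Diag_mult_vec inner_vec_def
    by (rule sum_nonneg) (simp add: mult.left_commute assms)
  moreover have "?y \<bullet> (BDiag w *v ?y) = x \<bullet> (R *v (BDiag w *v ?y))"
    by (simp add: dot_lmul_matrix)
  moreover have "x \<bullet> (R *v (BDiag w *v ?y)) + x \<bullet> x
      = x \<bullet> ((R ** BDiag w ** transpose R + mat 1) *v x)"
    by (simp add: matrix_vector_mult_add_rdistrib inner_add_right matrix_vector_mul_assoc[symmetric])
  ultimately have "x \<bullet> x \<le> 0" using x by simp
  then show "x = 0" by (metis inner_ge_zero order_antisym inner_eq_zero_iff)
qed

text \<open>
  The matrix \<open>Q B Q\<^sup>T + I\<close> is the identity on the orthogonal complement of the range of \<open>Q\<close> and acts as
  \<open>B + I\<close> on that range in the coordinates given by \<open>Q\<close>. Hence it can be inverted on the two subspaces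
  separately.
\<close>

lemma right_inverse_semi_orthogonal_update:
  fixes Q :: "real^'l::finite^'n::finite" and B :: "real^'l^'l"
  assumes Q: "transpose Q ** Q = mat 1" and B: "invertible (B + mat 1)"
  shows "(Q ** B ** transpose Q + mat 1)
      ** (mat 1 - Q ** transpose Q + Q ** matrix_inv (B + mat 1) ** transpose Q) = mat 1"
proof -
  let ?X = "matrix_inv (B + mat 1)"
  have Q': "transpose Q ** (Q ** Y) = Y" for Y :: "real^'n^'l"
    by (simp add: matrix_mul_assoc Q)
  have "(B + mat 1) ** ?X = mat 1" by (rule matrix_inv_mult_cancel[OF B])
  then have "B ** ?X = mat 1 - ?X" by (simp add: matrix_mult.add_left algebra_simps)
  then have BX: "B ** (?X ** Y) = Y - ?X ** Y" for Y :: "real^'n^'l"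
    by (simp add: matrix_mul_assoc matrix_mult.diff_left)
  show ?thesis
    by (simp add: matrix_mult.add_left matrix_mult.add_right matrix_mult.diff_left
        matrix_mult.diff_right matrix_mul_assoc[symmetric] Q' BX)
qed

text \<open>
  The inverse \<open>L\<^sup>-\<^sup>1\<close> as a function of the design: the covariance of the whitened posterior in the
  coordinates of the range of \<open>Q\<close>.
\<close>

definition reduced_cov :: "real^('o::finite \<times> 'm::finite)^'l::finite \<Rightarrow> real^'m \<Rightarrow> real^'l^'l" where
  "reduced_cov R w = matrix_inv (R ** BDiag w ** transpose R + mat 1)"

lemma transpose_reduced_cov:
  assumes "invertible (R ** BDiag w ** transpose R + mat 1)"
  shows "transpose (reduced_cov R w) = reduced_cov R w"
  using assms unfolding reduced_cov_def
  by (simp add: transpose_matrix_inv transpose_matrix_add matrix_transpose_mul BDiag_eq_Diag matrix_mul_assoc)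

lemma whitened_precision_inverse:
  fixes Q :: "real^'l::finite^'n::finite" and R :: "real^('o::finite \<times> 'm::finite)^'l"
  assumes FT: "transpose F = Q ** R" and Q: "transpose Q ** Q = mat 1"
    and L: "invertible (R ** BDiag w ** transpose R + mat 1)"
  shows "invertible (transpose F ** BDiag w ** F + mat 1)"
    and "matrix_inv (transpose F ** BDiag w ** F + mat 1)
      = mat 1 - Q ** transpose Q + Q ** reduced_cov R w ** transpose Q"
    and "matrix_inv (transpose F ** BDiag w ** F + mat 1) ** Q = Q ** reduced_cov R w"
proof -
  have F: "F = transpose R ** transpose Q"
    using FT[THEN arg_cong[of _ _ transpose]] by (simp only: matrix_transpose_mul transpose_transpose)
  have N: "transpose F ** BDiag w ** F + mat 1
      = Q ** (R ** BDiag w ** transpose R) ** transpose Q + mat 1"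
    unfolding FT unfolding F by (simp only: matrix_mul_assoc)
  from matrix_inv_eqI[OF right_inverse_semi_orthogonal_update[OF Q L]]
  show "invertible (transpose F ** BDiag w ** F + mat 1)"
    and eq: "matrix_inv (transpose F ** BDiag w ** F + mat 1)
      = mat 1 - Q ** transpose Q + Q ** reduced_cov R w ** transpose Q"
    unfolding N reduced_cov_def by auto
  show "matrix_inv (transpose F ** BDiag w ** F + mat 1) ** Q = Q ** reduced_cov R w"
    unfolding eq
    by (simp add: matrix_mult.add_left matrix_mult.diff_left matrix_mul_assoc[symmetric] Q)
qed

section \<open>Gradient and Hessian of the reduced objective\<close>

lemma has_derivative_reduced_cov:
  fixes R :: "real^('o::finite \<times> 'm::finite)^'l::finite"
  assumes "invertible (R ** BDiag w ** transpose R + mat 1)"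
  shows "(reduced_cov R has_derivative
    (\<lambda>h. - (reduced_cov R w ** (R ** BDiag h ** transpose R) ** reduced_cov R w))) (at w)"
proof -
  have "bounded_linear (\<lambda>h. R ** BDiag h ** transpose R)"
    by (rule bounded_linear_compose[OF matrix_mult.bounded_linear_left
          bounded_linear_compose[OF matrix_mult.bounded_linear_right bounded_linear_BDiag]])
  from has_derivative_add[OF bounded_linear_imp_has_derivative[OF this] has_derivative_const[of "mat 1"]]
  have "((\<lambda>w. R ** BDiag w ** transpose R + mat 1) has_derivative (\<lambda>h. R ** BDiag h ** transpose R)) (at w)"
    by simp
  from has_derivative_matrix_inv[OF this assms] show ?thesis
    unfolding reduced_cov_def[abs_def] .
qed

lemma sum_UNIV_prod: "(\<Sum>p\<in>UNIV. f p) = (\<Sum>l\<in>UNIV. \<Sum>k\<in>UNIV. f (l, k))"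
  for f :: "'o::finite \<times> 'm::finite \<Rightarrow> 'a::comm_monoid_add"
  by (simp add: sum.cartesian_product case_prod_eta)

lemma inner_block_sum: "h \<bullet> block_sum v = (\<Sum>p\<in>UNIV. h $ snd p * v $ p)"
proof -
  have "(\<Sum>p\<in>UNIV. h $ snd p * v $ p) = (\<Sum>l\<in>UNIV. \<Sum>k\<in>UNIV. h $ k * v $ (l, k))"
    by (simp add: sum_UNIV_prod)
  also have "\<dots> = (\<Sum>k\<in>UNIV. \<Sum>l\<in>UNIV. h $ k * v $ (l, k))" by (rule sum.swap)
  finally show ?thesis by (simp add: inner_vec_def block_sum_def sum_distrib_left)
qed

text \<open>
  By cyclic invariance, the directional derivative \<open>- tr(L\<^sup>-\<^sup>1 R D(h) R\<^sup>T L\<^sup>-\<^sup>1 C)\<close> is the trace of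
  \<open>D(h)\<close> times a matrix that does not depend on \<open>h\<close>. Only the diagonal of that matrix matters, and
  since all observations of one sensor share one weight, the diagonal is summed over the observations.
\<close>

lemma GDERIV_trace_reduced_cov:
  fixes R :: "real^('o::finite \<times> 'm::finite)^'l::finite"
  assumes inv: "invertible (R ** BDiag w ** transpose R + mat 1)"
  defines "X \<equiv> reduced_cov R w"
  shows "GDERIV (\<lambda>w. trace (reduced_cov R w ** C)) w :>
    block_sum (\<chi> p. - (transpose R ** X ** C ** X ** R) $ p $ p)"
  unfolding gderiv_def
proof (rule has_derivative_eq_rhs)
  show "((\<lambda>w. trace (reduced_cov R w ** C)) has_derivative
      (\<lambda>h. trace (- (X ** (R ** BDiag h ** transpose R) ** X) ** C))) (at w)"
    unfolding X_def
    by (intro bounded_linear.has_derivative[OF bounded_linear_trace]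
        bounded_linear.has_derivative[OF matrix_mult.bounded_linear_left]
        has_derivative_reduced_cov inv)
  show "(\<lambda>h. trace (- (X ** (R ** BDiag h ** transpose R) ** X) ** C))
      = (\<lambda>h. h \<bullet> block_sum (\<chi> p. - (transpose R ** X ** C ** X ** R) $ p $ p))"
  proof
    fix h
    have "trace (X ** (R ** BDiag h ** transpose R) ** X ** C)
        = trace ((X ** R) ** (BDiag h ** (transpose R ** X ** C)))"
      by (simp only: matrix_mul_assoc)
    also have "\<dots> = trace ((BDiag h ** (transpose R ** X ** C)) ** (X ** R))"
      by (rule trace_mul_sym)
    also have "\<dots> = trace (BDiag h ** (transpose R ** X ** C ** X ** R))"
      by (simp only: matrix_mul_assoc)
    also have "\<dots> = (\<Sum>p\<in>UNIV. h $ snd p * (transpose R ** X ** C ** X ** R) $ p $ p)"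
      by (simp add: BDiag_eq_Diag trace_Diag_mult)
    finally have "trace (X ** (R ** BDiag h ** transpose R) ** X ** C)
        = (\<Sum>p\<in>UNIV. h $ snd p * (transpose R ** X ** C ** X ** R) $ p $ p)" .
    then show "trace (- (X ** (R ** BDiag h ** transpose R) ** X) ** C)
        = h \<bullet> block_sum (\<chi> p. - (transpose R ** X ** C ** X ** R) $ p $ p)"
      by (simp add: inner_block_sum matrix_mult.minus_left sum_negf
          linear_neg[OF bounded_linear.linear[OF bounded_linear_trace]])
  qed
qed

lemma mult_BDiag_mult_component:
  "(A ** BDiag h ** B) $ p $ q = (\<Sum>r\<in>UNIV. A $ p $ r * h $ snd r * B $ r $ q)"
  unfolding BDiag_eq_Diag matrix_matrix_mult_def[of "A ** _"]
  by (simp add: mult_Diag_component)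

text \<open>
  This is where the Schur product in the Hessian comes from: on the diagonal, the product
  \<open>S D(h) P\<close> of symmetric matrices is linear in \<open>h\<close> with the entries of \<open>S \<odot> P\<close> as coefficients.
\<close>

lemma symmetric_conjugation_diagonal:
  assumes "transpose P = P" "transpose S = S"
  shows "(S ** BDiag h ** P + P ** BDiag h ** S) $ p $ p
    = (\<Sum>q\<in>UNIV. 2 * (S $ p $ q * P $ p $ q) * h $ snd q)"
proof -
  have "P $ q $ p = P $ p $ q" "S $ q $ p = S $ p $ q" for q
    using assms[THEN arg_cong[of _ _ "\<lambda>A. A $ p $ q"]] by (simp_all add: transpose_def)
  then show ?thesis
    by (simp only: vector_add_component mult_BDiag_mult_component sum.distrib[symmetric])
      (simp add: mult_ac)
qed

lemma slice_congruence_component: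
  "(transpose (slice R k) ** A ** slice R l) $ j $ i = (transpose R ** A ** R) $ (k, j) $ (l, i)"
  by (simp add: slice_def matrix_matrix_mult_def transpose_def)

text \<open>
  Both factors \<open>L\<^sup>-\<^sup>1\<close> in \<open>S = R\<^sup>T L\<^sup>-\<^sup>1 C L\<^sup>-\<^sup>1 R\<close> contribute to the derivative. With
  \<open>P = R\<^sup>T L\<^sup>-\<^sup>1 R\<close>, the derivative of \<open>- S\<close> is \<open>S D(h) P + P D(h) S\<close>. The two summands are transposes of
  each other and have the same diagonal, hence the factor 2. Summing the diagonal and the
  coefficients over the observations produces the double sum over slices of \<open>R\<close>.
\<close>

lemma gradient_has_derivative:
  fixes R :: "real^('o::finite \<times> 'm::finite)^'l::finite"
  assumes inv: "invertible (R ** BDiag w ** transpose R + mat 1)" and C: "transpose C = C"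
  defines "X \<equiv> reduced_cov R w"
  shows "((\<lambda>w. block_sum (\<chi> p. - (transpose R ** reduced_cov R w ** C ** reduced_cov R w ** R) $ p $ p))
    has_derivative (\<lambda>h.
      (\<Sum>k\<in>UNIV. \<Sum>l\<in>UNIV. 2 *\<^sub>R
        ((transpose (slice R k) ** X ** C ** X ** slice R l)
          \<odot> (transpose (slice R k) ** X ** slice R l))) *v h)) (at w)"
proof (rule has_derivative_eq_rhs)
  let ?d = "\<lambda>A :: real^('o \<times> 'm)^('o \<times> 'm). block_sum (\<chi> p. - A $ p $ p)"
  let ?P = "transpose R ** X ** R" and ?S = "transpose R ** X ** C ** X ** R"
  let ?dX = "\<lambda>h. - (X ** (R ** BDiag h ** transpose R) ** X)"
  have d: "bounded_linear ?d"
    unfolding linear_conv_bounded_linear[symmetric]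
    by (auto intro!: linearI simp: vec_eq_iff block_sum_def sum_negf sum_subtractf sum.distrib sum_distrib_left)
  have dX: "(reduced_cov R has_derivative ?dX) (at w)"
    unfolding X_def by (rule has_derivative_reduced_cov[OF inv])
  show "((\<lambda>w. ?d (transpose R ** reduced_cov R w ** C ** reduced_cov R w ** R)) has_derivative
      (\<lambda>h. ?d ((transpose R ** X ** C ** ?dX h + transpose R ** ?dX h ** C ** X) ** R))) (at w)"
    unfolding X_def
    by (intro bounded_linear.has_derivative[OF d]
        bounded_linear.has_derivative[OF matrix_mult.bounded_linear_left]
        bounded_linear.has_derivative[OF matrix_mult.bounded_linear_right]
        matrix_mult.FDERIV dX[unfolded X_def])
  have X: "transpose X = X" unfolding X_def by (rule transpose_reduced_cov[OF inv])
  have sym: "transpose ?P = ?P" "transpose ?S = ?S"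
    by (simp_all add: matrix_transpose_mul X C matrix_mul_assoc)
  show "(\<lambda>h. ?d ((transpose R ** X ** C ** ?dX h + transpose R ** ?dX h ** C ** X) ** R))
      = (\<lambda>h. (\<Sum>k\<in>UNIV. \<Sum>l\<in>UNIV. 2 *\<^sub>R
          ((transpose (slice R k) ** X ** C ** X ** slice R l)
            \<odot> (transpose (slice R k) ** X ** slice R l))) *v h)"
  proof
    fix h
    have "(transpose R ** X ** C ** ?dX h + transpose R ** ?dX h ** C ** X) ** R
        = - (?S ** BDiag h ** ?P + ?P ** BDiag h ** ?S)"
      by (simp add: matrix_mult.add_left matrix_mult.diff_left matrix_mult.minus_left
          matrix_mult.minus_right matrix_mul_assoc)
    then have "?d ((transpose R ** X ** C ** ?dX h + transpose R ** ?dX h ** C ** X) ** R)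
        = block_sum (\<chi> p. (?S ** BDiag h ** ?P + ?P ** BDiag h ** ?S) $ p $ p)"
      by (simp only: vector_uminus_component minus_minus)
    also have "\<dots> = block_sum (\<chi> p. \<Sum>q\<in>UNIV. 2 * (?S $ p $ q * ?P $ p $ q) * h $ snd q)"
      unfolding symmetric_conjugation_diagonal[OF sym] ..
    also have "\<dots> = (\<Sum>k\<in>UNIV. \<Sum>l\<in>UNIV. 2 *\<^sub>R
          ((transpose (slice R k) ** X ** C ** X ** slice R l)
            \<odot> (transpose (slice R k) ** X ** slice R l))) *v h" (is "?lhs = ?H *v h")
    proof (subst vec_eq_iff, rule allI)
      fix j
      have H: "?H $ j $ i = (\<Sum>k\<in>UNIV. \<Sum>l\<in>UNIV. 2 * (?S $ (k, j) $ (l, i) * ?P $ (k, j) $ (l, i)))" for i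
        using slice_congruence_component[of R _ "X ** C ** X" _ j i]
          slice_congruence_component[of R _ X _ j i]
        by (simp add: schur_product_def matrix_mul_assoc)
      have "?lhs $ j = (\<Sum>k\<in>UNIV. \<Sum>l\<in>UNIV. \<Sum>i\<in>UNIV. 2 * (?S $ (k, j) $ (l, i) * ?P $ (k, j) $ (l, i)) * h $ i)"
        by (simp add: block_sum_def sum_UNIV_prod)
      also have "\<dots> = (\<Sum>k\<in>UNIV. \<Sum>i\<in>UNIV. \<Sum>l\<in>UNIV. 2 * (?S $ (k, j) $ (l, i) * ?P $ (k, j) $ (l, i)) * h $ i)"
        by (intro sum.cong refl sum.swap)
      also have "\<dots> = (\<Sum>i\<in>UNIV. \<Sum>k\<in>UNIV. \<Sum>l\<in>UNIV. 2 * (?S $ (k, j) $ (l, i) * ?P $ (k, j) $ (l, i)) * h $ i)"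
        by (rule sum.swap)
      also have "\<dots> = (?H *v h) $ j"
        by (simp only: matrix_vector_mult_def H vec_lambda_beta sum_distrib_right)
      finally show "?lhs $ j = (?H *v h) $ j" .
    qed
    finally show "?d ((transpose R ** X ** C ** ?dX h + transpose R ** ?dX h ** C ** X) ** R)
        = ?H *v h" .
  qed
qed

section \<open>Whitening the posterior\<close>

lemma matrix_cancel_left:
  fixes A :: "real^'n^'n" and Y :: "real^'k^'n"
  assumes "A ** B = mat 1"
  shows "A ** (B ** Y) = Y"
  by (simp add: matrix_mul_assoc assms)

text \<open>
  By definition \<open>F\<close> is the noise-weighted forward map composed with \<open>K\<^sup>-\<^sup>1 M Mh\<^sup>-\<^sup>1\<close>. Solving for the forward
  map brings out the right factor \<open>Mh M\<^sup>-\<^sup>1 K\<close> of the precision, and solving for its adjoint the left factor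
  \<open>M\<^sup>-\<^sup>1 K Mh\<^sup>-\<^sup>1\<close>; the latter requires \<open>K\<close> to be symmetric and \<open>Mh\<^sup>-\<^sup>T M = Mh\<close>. The product of the
  two factors is the prior precision, which explains the identity matrix in the middle.
\<close>

lemma post_precision_whitened:
  fixes M K Mh :: "real^'n^'n" and Fo :: "real^'n^('o::finite \<times> 'm::finite)"
  assumes M: "M = transpose Mh ** Mh" "invertible M" "invertible Mh"
    and K: "invertible K" "transpose K = K"
    and F: "F = diag_inv_sqrt \<Gamma> ** Fo ** prior_cov_sqrt M K ** matrix_inv Mh"
  shows "M_adjoint M Fo ** diag_inv_sqrt \<Gamma> = matrix_inv M ** K ** matrix_inv Mh ** transpose F"
    and "post_precision M K Fo \<Gamma> w =
      (matrix_inv M ** K ** matrix_inv Mh) ** (transpose F ** BDiag w ** F + mat 1)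
        ** (Mh ** matrix_inv M ** K)"
proof -
  note inv = matrix_inv_mult_cancel[OF M(3)] matrix_inv_mult_cancel[OF K(1)]
    matrix_inv_mult_cancel[OF M(2)]
  note cancel = inv inv[THEN matrix_cancel_left]
  have G: "transpose (diag_inv_sqrt \<Gamma>) = diag_inv_sqrt \<Gamma>" by (simp add: diag_inv_sqrt_def)
  have Msym: "transpose M = M" by (simp add: M(1) matrix_transpose_mul)
  have MhT: "transpose (matrix_inv Mh) ** M = Mh"
    by (simp add: M(1) matrix_mul_assoc matrix_transpose_mul[symmetric] inv)
  have "transpose F = transpose (matrix_inv Mh) ** M ** matrix_inv K ** transpose Fo ** diag_inv_sqrt \<Gamma>"
    by (simp add: F prior_cov_sqrt_def matrix_transpose_mul transpose_matrix_inv K Msym G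
        matrix_mul_assoc)
  then have FT: "transpose F = Mh ** matrix_inv K ** transpose Fo ** diag_inv_sqrt \<Gamma>"
    unfolding MhT .
  show adj: "M_adjoint M Fo ** diag_inv_sqrt \<Gamma> = matrix_inv M ** K ** matrix_inv Mh ** transpose F"
    by (simp add: FT M_adjoint_def matrix_mul_assoc[symmetric] cancel)
  have GF: "diag_inv_sqrt \<Gamma> ** Fo = F ** (Mh ** matrix_inv M ** K)"
    by (simp add: F prior_cov_sqrt_def matrix_mul_assoc[symmetric] cancel)
  have "matrix_inv (prior_cov M K) = matrix_inv M ** K ** (matrix_inv M ** K)"
    by (rule matrix_inv_eqI)
      (simp add: prior_cov_def prior_cov_sqrt_def matrix_mul_assoc[symmetric] cancel)
  then have C0: "matrix_inv (prior_cov M K)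
      = (matrix_inv M ** K ** matrix_inv Mh) ** (Mh ** matrix_inv M ** K)"
    by (simp add: matrix_mul_assoc[symmetric] cancel)
  have "post_precision M K Fo \<Gamma> w
      = (M_adjoint M Fo ** diag_inv_sqrt \<Gamma>) ** BDiag w ** (diag_inv_sqrt \<Gamma> ** Fo)
        + matrix_inv (prior_cov M K)"
    by (simp add: post_precision_def matrix_mul_assoc)
  also have "\<dots> = (matrix_inv M ** K ** matrix_inv Mh) ** (transpose F ** BDiag w ** F + mat 1)
        ** (Mh ** matrix_inv M ** K)"
    unfolding adj GF C0
    by (simp add: matrix_mult.add_left matrix_mult.add_right matrix_mul_assoc)
  finally show "post_precision M K Fo \<Gamma> w = \<dots>" .
qed

lemma post_cov_whitened:
  fixes M K Mh :: "real^'n^'n" and Fo :: "real^'n^('o::finite \<times> 'm::finite)"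
  assumes M: "M = transpose Mh ** Mh" "invertible M" "invertible Mh"
    and K: "invertible K" "transpose K = K"
    and F: "F = diag_inv_sqrt \<Gamma> ** Fo ** prior_cov_sqrt M K ** matrix_inv Mh"
    and N: "invertible (transpose F ** BDiag w ** F + mat 1)"
  shows "invertible (post_precision M K Fo \<Gamma> w)"
    and "post_cov M K Fo \<Gamma> w = prior_cov_sqrt M K ** matrix_inv Mh
      ** matrix_inv (transpose F ** BDiag w ** F + mat 1) ** Mh ** prior_cov_sqrt M K"
proof -
  note inv = matrix_inv_mult_cancel[OF M(3)] matrix_inv_mult_cancel[OF K(1)]
    matrix_inv_mult_cancel[OF M(2)] matrix_inv_mult_cancel[OF N]
  note cancel = inv inv[THEN matrix_cancel_left]
  define N where "N = transpose F ** BDiag w ** F + mat 1"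
  note cancel = cancel[folded N_def]
  have *: "post_precision M K Fo \<Gamma> w ** (prior_cov_sqrt M K ** matrix_inv Mh
      ** matrix_inv N ** Mh ** prior_cov_sqrt M K) = mat 1"
    unfolding post_precision_whitened(2)[OF M K F] N_def[symmetric]
    by (simp add: prior_cov_sqrt_def matrix_mul_assoc[symmetric] cancel)
  from matrix_inv_eqI[OF *]
  show "invertible (post_precision M K Fo \<Gamma> w)"
    and "post_cov M K Fo \<Gamma> w = prior_cov_sqrt M K ** matrix_inv Mh
      ** matrix_inv (transpose F ** BDiag w ** F + mat 1) ** Mh ** prior_cov_sqrt M K"
    unfolding post_cov_def N_def by auto
qed

text \<open>
  The gain \<open>C\<^sub>p\<^sub>o\<^sub>s\<^sub>t F\<^sub>w\<^sup>* \<Gamma>\<^sup>-\<^sup>1\<close> equals \<open>T D\<close>, where \<open>T\<close> is the data-to-mean matrix of the claim. The same product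
  \<open>T D\<close> occurs when the identity \<open>C\<^sub>p\<^sub>o\<^sub>s\<^sub>t P = I\<close> for the precision \<open>P\<close> is expanded, which gives
  \<open>m0 = T D Fo m0 + C\<^sub>p\<^sub>o\<^sub>s\<^sub>t C0\<^sup>-\<^sup>1 m0\<close>. The precision contains \<open>D\<close> once and the gain applied to
  \<open>F\<^sub>w m0\<close> contains it twice, so for a relaxed design the terms in \<open>m0\<close> do not cancel and leave the
  correction \<open>(I - D) Fo m0\<close> of the data.
\<close>

lemma post_mean_whitened:
  fixes M K Mh :: "real^'n^'n" and Fo :: "real^'n^('o::finite \<times> 'm::finite)"
    and Q :: "real^'l::finite^'n"
  assumes M: "M = transpose Mh ** Mh" "invertible M" "invertible Mh"
    and K: "invertible K" "transpose K = K"
    and F: "F = diag_inv_sqrt \<Gamma> ** Fo ** prior_cov_sqrt M K ** matrix_inv Mh"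
    and \<Gamma>: "\<And>p q. p \<noteq> q \<Longrightarrow> \<Gamma> $ p $ q = 0" "\<And>p. 0 < \<Gamma> $ p $ p"
    and FT: "transpose F = Q ** R" and Q: "transpose Q ** Q = mat 1"
    and L: "invertible (R ** BDiag w ** transpose R + mat 1)"
  shows "post_mean M K Fo \<Gamma> g m0 w =
    (prior_cov_sqrt M K ** matrix_inv Mh ** Q ** reduced_cov R w ** R ** diag_inv_sqrt \<Gamma>)
      *v (BDiag w *v (g + (mat 1 - BDiag w) *v (Fo *v m0)))
    + (post_cov M K Fo \<Gamma> w ** matrix_inv (prior_cov M K)) *v m0"
proof -
  let ?G = "diag_inv_sqrt \<Gamma>" and ?D = "BDiag w :: real^('o \<times> 'm)^('o \<times> 'm)"
  let ?Cp = "post_cov M K Fo \<Gamma> w"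
  let ?T = "prior_cov_sqrt M K ** matrix_inv Mh ** Q ** reduced_cov R w ** R ** ?G"
  note N = whitened_precision_inverse[OF FT Q L]
  note inv = matrix_inv_mult_cancel[OF M(3)] matrix_inv_mult_cancel[OF K(1)]
    matrix_inv_mult_cancel[OF M(2)]
  note cancel = inv inv[THEN matrix_cancel_left]
  have DG: "?D ** ?G = ?G ** ?D"
    by (simp add: BDiag_eq_Diag diag_inv_sqrt_def Diag_commute)
  have "?Cp ** (M_adjoint M Fo ** ?G) = prior_cov_sqrt M K ** matrix_inv Mh
      ** (matrix_inv (transpose F ** BDiag w ** F + mat 1) ** transpose F)"
    unfolding post_cov_whitened(2)[OF M K F N(1)] post_precision_whitened(1)[OF M K F]
    by (simp add: prior_cov_sqrt_def matrix_mul_assoc[symmetric] cancel)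
  also have "\<dots> = prior_cov_sqrt M K ** matrix_inv Mh ** Q ** reduced_cov R w ** R"
    unfolding FT using N(3) by (simp add: matrix_mul_assoc FT)
  finally have "?Cp ** M_adjoint M Fo ** ?G ** ?D ** ?G = ?T ** ?D"
    by (simp add: matrix_mul_assoc[symmetric] DG)
  then have TD: "?Cp ** (M_adjoint M Fo ** ?G ** ?D ** ?G) = ?T ** ?D"
    by (simp only: matrix_mul_assoc)
  have "M_adjoint M (?D ** Fo) = M_adjoint M Fo ** ?D"
    by (simp add: M_adjoint_def matrix_transpose_mul BDiag_eq_Diag matrix_mul_assoc)
  moreover have "matrix_inv \<Gamma> = ?G ** ?G" by (rule diag_inv_sqrt_squared[OF \<Gamma>])
  ultimately have "?Cp ** M_adjoint M (?D ** Fo) ** matrix_inv \<Gamma>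
      = ?Cp ** M_adjoint M Fo ** (?D ** ?G) ** ?G"
    by (simp only: matrix_mul_assoc)
  also have "\<dots> = ?T ** ?D"
    unfolding DG TD[symmetric] by (simp only: matrix_mul_assoc)
  finally have gain: "?Cp ** M_adjoint M (?D ** Fo) ** matrix_inv \<Gamma> = ?T ** ?D" .
  have "mat 1 = ?Cp ** post_precision M K Fo \<Gamma> w"
    unfolding post_cov_def
    by (rule matrix_inv_mult_cancel(2)[OF post_cov_whitened(1)[OF M K F N(1)], symmetric])
  also have "\<dots> = ?T ** ?D ** Fo + ?Cp ** matrix_inv (prior_cov M K)"
    unfolding post_precision_def matrix_mult.add_right TD[symmetric]
    by (simp only: matrix_mul_assoc)
  finally have one: "mat 1 = ?T ** ?D ** Fo + ?Cp ** matrix_inv (prior_cov M K)" .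
  have "m0 = (?T ** ?D ** Fo + ?Cp ** matrix_inv (prior_cov M K)) *v m0"
    by (simp only: one[symmetric] matrix_vector_mul_lid)
  then have m0: "m0 = ?T *v (?D *v (Fo *v m0)) + (?Cp ** matrix_inv (prior_cov M K)) *v m0"
    by (simp only: matrix_vector_mult_add_rdistrib matrix_vector_mul_assoc matrix_mul_assoc)
  have "post_mean M K Fo \<Gamma> g m0 w = m0 + ?T *v (?D *v (g - ?D *v (Fo *v m0)))"
    unfolding post_mean_def gain by (simp only: matrix_vector_mul_assoc)
  also have "\<dots> = ?T *v (?D *v (Fo *v m0)) + ?T *v (?D *v (g - ?D *v (Fo *v m0)))
      + (?Cp ** matrix_inv (prior_cov M K)) *v m0"
    by (subst m0) simp
  also have "\<dots> = ?T *v (?D *v (g + (mat 1 - ?D) *v (Fo *v m0)))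
      + (?Cp ** matrix_inv (prior_cov M K)) *v m0"
    by (simp add: matrix_vector_mult_diff_rdistrib matrix_vector_mult_diff_distrib
        matrix_vector_right_distrib)
  finally show ?thesis .
qed

text \<open>
  Only \<open>L\<^sup>-\<^sup>1\<close> depends on the design; the other two traces come from the projection
  \<open>I - Q Q\<^sup>T\<close> in \<open>N\<^sup>-\<^sup>1\<close>.
\<close>

lemma objective_reduced:
  fixes M K Mh :: "real^'n^'n" and Fo :: "real^'n^('o::finite \<times> 'm::finite)"
    and Q :: "real^'l::finite^'n"
  assumes M: "M = transpose Mh ** Mh" "invertible M" "invertible Mh"
    and K: "invertible K" "transpose K = K"
    and F: "F = diag_inv_sqrt \<Gamma> ** Fo ** prior_cov_sqrt M K ** matrix_inv Mh"
    and FT: "transpose F = Q ** R" and Q: "transpose Q ** Q = mat 1"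
    and L: "invertible (R ** BDiag w ** transpose R + mat 1)"
  defines "B \<equiv> Mh ** prior_cov M K ** matrix_inv Mh"
  shows "trace (post_cov M K Fo \<Gamma> w) = trace (matrix_inv (transpose F ** BDiag w ** F + mat 1) ** B)"
    and "trace (post_cov M K Fo \<Gamma> w) = trace (prior_cov M K) - trace (transpose Q ** B ** Q)
      + trace (reduced_cov R w ** (transpose Q ** B ** Q))"
proof -
  let ?N = "transpose F ** BDiag w ** F + mat 1"
  note N = whitened_precision_inverse[OF FT Q L]
  have "trace (post_cov M K Fo \<Gamma> w)
      = trace ((prior_cov_sqrt M K ** matrix_inv Mh) ** (matrix_inv ?N ** Mh ** prior_cov_sqrt M K))"
    unfolding post_cov_whitened(2)[OF M K F N(1)] by (simp only: matrix_mul_assoc)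
  also have "\<dots> = trace ((matrix_inv ?N ** Mh ** prior_cov_sqrt M K) ** (prior_cov_sqrt M K ** matrix_inv Mh))"
    by (rule trace_mul_sym)
  also have "\<dots> = trace (matrix_inv ?N ** B)"
    by (simp only: B_def prior_cov_def matrix_mul_assoc)
  finally show J: "trace (post_cov M K Fo \<Gamma> w) = trace (matrix_inv ?N ** B)" .
  have "trace B = trace (matrix_inv Mh ** (Mh ** prior_cov M K))"
    unfolding B_def by (rule trace_mul_sym)
  then have B: "trace B = trace (prior_cov M K)"
    by (simp add: matrix_mul_assoc matrix_inv_mult_cancel[OF M(3)])
  have QQ: "trace (Q ** transpose Q ** B) = trace (transpose Q ** B ** Q)"
    using trace_mul_sym[of Q "transpose Q ** B"] by (simp only: matrix_mul_assoc)
  have QXQ: "trace (Q ** reduced_cov R w ** transpose Q ** B)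
      = trace (reduced_cov R w ** (transpose Q ** B ** Q))"
    using trace_mul_sym[of Q "reduced_cov R w ** transpose Q ** B"] by (simp only: matrix_mul_assoc)
  show "trace (post_cov M K Fo \<Gamma> w) = trace (prior_cov M K) - trace (transpose Q ** B ** Q)
      + trace (reduced_cov R w ** (transpose Q ** B ** Q))"
    unfolding J N(2) by (simp add: matrix_mult.add_left matrix_mult.diff_left trace_add trace_sub B QQ QXQ)
qed

section \<open>The multiple-observation A-optimal design problem\<close>

theorem theorem17:
  fixes \<Omega> :: "(real^'d::finite) set"
    and dom :: "(real^'d \<Rightarrow> real) set"
    and \<KK> \<GG> :: "(real^'d \<Rightarrow> real) \<Rightarrow> (real^'d \<Rightarrow> real)"
    and node :: "'n::finite \<Rightarrow> real^'d"
    and \<phi> :: "'n \<Rightarrow> real^'d \<Rightarrow> real"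
    and M K Mh C0 C0h :: "real^'n^'n"
    and Fs :: "'o::finite \<Rightarrow> real^'n^'m::finite"
    and Fo F :: "real^'n^('o \<times> 'm)"
    and \<Gamma> :: "real^('o \<times> 'm)^('o \<times> 'm)"
    and \<J> :: "real^'m \<Rightarrow> real"
    and Q :: "real^'l::finite^'n"
    and R :: "real^('o \<times> 'm)^'l"
    and L :: "real^'m \<Rightarrow> real^'l^'l"
    and C Ch :: "real^'l^'l"
  assumes "compact \<Omega>"
    and "L2_operator \<Omega> dom \<KK>"
    and "densely_defined \<Omega> dom"
    and "selfadjoint_solution_operator \<Omega> dom \<KK> \<GG>"
    and "\<And>i. \<phi> i \<in> L2 \<Omega> \<inter> dom"
    and "L2_independent \<Omega> \<phi>"
    and "lagrange_basis \<Omega> node \<phi>"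
    and "M = mass_matrix \<Omega> \<phi>"
    and "K = stiffness_matrix \<Omega> \<KK> \<phi>"
    and "invertible K"
    and "M = transpose Mh ** Mh"
    and "C0h = prior_cov_sqrt M K"
    and "C0 = prior_cov M K"
    and "Fo = stack Fs"
    and "\<And>p q. p \<noteq> q \<Longrightarrow> \<Gamma> $ p $ q = 0"
    and "\<And>p. 0 < \<Gamma> $ p $ p"
    and "\<J> = (\<lambda>w. trace (post_cov M K Fo \<Gamma> w))"
    and "F = diag_inv_sqrt \<Gamma> ** Fo ** C0h ** matrix_inv Mh"
    and "transpose F = Q ** R"
    and "transpose Q ** Q = mat 1"
    and "L = (\<lambda>w. R ** BDiag w ** transpose R + mat 1)"
    and "C = transpose Q ** Mh ** C0 ** matrix_inv Mh ** Q"
    and "C = transpose Ch ** Ch"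
  shows "\<exists>U. open U \<and> {w. \<forall>k. 0 \<le> w $ k \<and> w $ k \<le> 1} \<subseteq> U \<and>
    (\<forall>w\<in>U.
      invertible (post_precision M K Fo \<Gamma> w) \<and>
      invertible (transpose F ** BDiag w ** F + mat 1) \<and>
      invertible (L w) \<and>
      (\<forall>g m0. (\<forall>k. w $ k \<in> {0, 1}) \<and> BDiag w *v g = g \<longrightarrow>
        post_mean M K Fo \<Gamma> g m0 w =
          (C0h ** matrix_inv Mh ** Q ** matrix_inv (L w) ** R ** diag_inv_sqrt \<Gamma>) *v g
          + (post_cov M K Fo \<Gamma> w ** matrix_inv C0) *v m0) \<and>
      (\<forall>g m0. (\<forall>k. w $ k \<in> {0, 1}) \<longrightarrow>
        post_mean M K Fo \<Gamma> g m0 w =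
          (C0h ** matrix_inv Mh ** Q ** matrix_inv (L w) ** R ** diag_inv_sqrt \<Gamma>) *v (BDiag w *v g)
          + (post_cov M K Fo \<Gamma> w ** matrix_inv C0) *v m0) \<and>
      (\<forall>g m0.
        post_mean M K Fo \<Gamma> g m0 w =
          (C0h ** matrix_inv Mh ** Q ** matrix_inv (L w) ** R ** diag_inv_sqrt \<Gamma>)
            *v (BDiag w *v (g + (mat 1 - BDiag w) *v (Fo *v m0)))
          + (post_cov M K Fo \<Gamma> w ** matrix_inv C0) *v m0) \<and>
      post_cov M K Fo \<Gamma> w =
        C0h ** matrix_inv Mh
          ** (mat 1 - Q ** transpose Q + Q ** matrix_inv (L w) ** transpose Q) ** Mh ** C0h \<and>
      \<J> w = trace (matrix_inv (transpose F ** BDiag w ** F + mat 1) ** Mh ** C0 ** matrix_inv Mh) \<and>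
      \<J> w = trace C0 - trace C + trace (matrix_inv (L w) ** C) \<and>
      GDERIV \<J> w :>
        block_sum (\<chi> p. - (norm ((Ch ** matrix_inv (L w) ** R) *v axis p 1))\<^sup>2) \<and>
      has_hessian \<J>
        (\<Sum>k\<in>UNIV. \<Sum>l\<in>UNIV.
          2 *\<^sub>R ((transpose (slice R k) ** matrix_inv (L w) ** C ** matrix_inv (L w) ** slice R l)
                 \<odot> (transpose (slice R k) ** matrix_inv (L w) ** slice R l))) w)"
proof -
  have M: "M = transpose Mh ** Mh" by (rule assms(11))
  have L2: "\<phi> i \<in> L2 \<Omega>" "\<phi> i \<in> dom" for i using assms(5)[of i] by auto
  have Minv: "invertible M"
    unfolding assms(8) by (rule invertible_mass_matrix[OF L2(1) assms(6)])
  have Mhinv: "invertible Mh"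
    using Minv unfolding M invertible_det_nz det_mul by simp
  have K: "invertible K" "transpose K = K"
    using assms(10) unfolding assms(9) by (auto intro: stiffness_matrix_symmetric[OF assms(2,4) L2(2)])
  have F: "F = diag_inv_sqrt \<Gamma> ** Fo ** prior_cov_sqrt M K ** matrix_inv Mh"
    using assms(18) unfolding assms(12) .
  note FT = assms(19) and Q = assms(20)
  have X: "matrix_inv (L w) = reduced_cov R w" for w
    by (simp add: assms(21) reduced_cov_def)
  have C: "transpose Q ** (Mh ** prior_cov M K ** matrix_inv Mh) ** Q = C"
    by (simp only: assms(22) assms(13) matrix_mul_assoc)
  have Csym: "transpose C = C" by (simp add: assms(23) matrix_transpose_mul)
  \<comment> \<open>The formulas hold wherever the reduced precision is invertible, and this set is open because
    the determinant is continuous.\<close>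
  let ?U = "{w. det (L w) \<noteq> 0}"
  have "continuous_on UNIV L"
    unfolding assms(21)
    by (intro continuous_on_add continuous_on_const matrix_mult.continuous_on
        linear_continuous_on bounded_linear_BDiag)
  then have "continuous_on UNIV (\<lambda>w. det (L w))"
    by (rule continuous_on_compose2[OF continuous_on_det[of UNIV]]) simp
  then have U: "open ?U"
    by (intro open_Collect_neq continuous_on_const)
  have inv: "invertible (R ** BDiag w ** transpose R + mat 1)" if "w \<in> ?U" for w
    using that by (simp add: assms(21) invertible_det_nz)
  have J: "\<J> y = trace C0 - trace C + trace (reduced_cov R y ** C)" if "y \<in> ?U" for y
    unfolding assms(17) assms(13)
    using objective_reduced(2)[OF M Minv Mhinv K F FT Q inv[OF that]] unfolding C .
  let ?grad = "\<lambda>w. block_sum (\<chi> p. - (transpose R ** reduced_cov R w ** C ** reduced_cov R w ** R) $ p $ p)"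
  have grad: "GDERIV \<J> w :> ?grad w" if w: "w \<in> ?U" for w
  proof -
    have "GDERIV (\<lambda>y. trace C0 - trace C + trace (reduced_cov R y ** C)) w :> ?grad w"
      using GDERIV_add[OF GDERIV_const[of "trace C0 - trace C" w] GDERIV_trace_reduced_cov[OF inv[OF w]]]
      by simp
    then show ?thesis
      unfolding gderiv_def by (rule has_derivative_transform_within_open[OF _ U w]) (simp add: J)
  qed
  have norm_eq: "(norm ((Ch ** reduced_cov R w ** R) *v axis p 1))\<^sup>2
      = (transpose R ** reduced_cov R w ** C ** reduced_cov R w ** R) $ p $ p" if "w \<in> ?U" for w p
  proof -
    let ?B = "Ch ** reduced_cov R w ** R"
    \<comment> \<open>A diagonal entry of a Gram matrix is the squared norm of a column.\<close>
    have "transpose R ** reduced_cov R w ** C ** reduced_cov R w ** R = transpose ?B ** ?B"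
      by (simp add: assms(23) matrix_transpose_mul transpose_reduced_cov[OF inv[OF that]] matrix_mul_assoc)
    then show ?thesis
      by (simp add: matrix_vector_mult_basis power2_norm_eq_inner matrix_mult_transpose_dot_column)
  qed
  have hess: "has_hessian \<J>
        (\<Sum>k\<in>UNIV. \<Sum>l\<in>UNIV.
          2 *\<^sub>R ((transpose (slice R k) ** reduced_cov R w ** C ** reduced_cov R w ** slice R l)
                 \<odot> (transpose (slice R k) ** reduced_cov R w ** slice R l))) w" if w: "w \<in> ?U" for w
    unfolding has_hessian_def
  proof (intro exI[of _ ?grad] conjI)
    show "\<forall>\<^sub>F y in nhds w. GDERIV \<J> y :> ?grad y"
      using eventually_nhds_in_open[OF U w] by eventually_elim (rule grad)
  qed (rule gradient_has_derivative[OF inv[OF w] Csym])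
  show ?thesis
  proof (intro exI[of _ ?U] conjI ballI)
    show "open ?U" by (rule U)
    show "{w. \<forall>k. 0 \<le> w $ k \<and> w $ k \<le> 1} \<subseteq> ?U"
      using invertible_reduced_precision[of _ R] by (auto simp: assms(21) invertible_det_nz)
    fix w assume w: "w \<in> ?U"
    note N = whitened_precision_inverse[OF FT Q inv[OF w]]
    note cov = post_cov_whitened[OF M Minv Mhinv K F N(1)]
    note obj = objective_reduced[OF M Minv Mhinv K F FT Q inv[OF w]]
    show "invertible (post_precision M K Fo \<Gamma> w)" by (rule cov(1))
    show "invertible (transpose F ** BDiag w ** F + mat 1)" by (rule N(1))
    show "invertible (L w)" using w by (simp add: invertible_det_nz)
    have mean: "post_mean M K Fo \<Gamma> g m0 w =
          (C0h ** matrix_inv Mh ** Q ** matrix_inv (L w) ** R ** diag_inv_sqrt \<Gamma>)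
            *v (BDiag w *v (g + (mat 1 - BDiag w) *v (Fo *v m0)))
          + (post_cov M K Fo \<Gamma> w ** matrix_inv C0) *v m0" for g m0
      unfolding X assms(12) assms(13)
      by (rule post_mean_whitened[OF M Minv Mhinv K F assms(15,16) FT Q inv[OF w]])
    have mean01: "post_mean M K Fo \<Gamma> g m0 w =
          (C0h ** matrix_inv Mh ** Q ** matrix_inv (L w) ** R ** diag_inv_sqrt \<Gamma>) *v (BDiag w *v g)
          + (post_cov M K Fo \<Gamma> w ** matrix_inv C0) *v m0" if "\<forall>k. w $ k \<in> {0, 1}" for g m0
      unfolding mean using that
      by (simp add: BDiag_binary_idem matrix_vector_mult_diff_rdistrib matrix_vector_mult_diff_distrib
          matrix_vector_right_distrib)
    show "\<forall>g m0. post_mean M K Fo \<Gamma> g m0 w =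
          (C0h ** matrix_inv Mh ** Q ** matrix_inv (L w) ** R ** diag_inv_sqrt \<Gamma>)
            *v (BDiag w *v (g + (mat 1 - BDiag w) *v (Fo *v m0)))
          + (post_cov M K Fo \<Gamma> w ** matrix_inv C0) *v m0"
      by (intro allI mean)
    show "\<forall>g m0. (\<forall>k. w $ k \<in> {0, 1}) \<longrightarrow>
        post_mean M K Fo \<Gamma> g m0 w =
          (C0h ** matrix_inv Mh ** Q ** matrix_inv (L w) ** R ** diag_inv_sqrt \<Gamma>) *v (BDiag w *v g)
          + (post_cov M K Fo \<Gamma> w ** matrix_inv C0) *v m0"
      using mean01 by blast
    show "\<forall>g m0. (\<forall>k. w $ k \<in> {0, 1}) \<and> BDiag w *v g = g \<longrightarrow>
        post_mean M K Fo \<Gamma> g m0 w =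
          (C0h ** matrix_inv Mh ** Q ** matrix_inv (L w) ** R ** diag_inv_sqrt \<Gamma>) *v g
          + (post_cov M K Fo \<Gamma> w ** matrix_inv C0) *v m0"
    proof (intro allI impI)
      fix g :: "real^('o \<times> 'm)" and m0 assume a: "(\<forall>k. w $ k \<in> {0, 1}) \<and> BDiag w *v g = g"
      show "post_mean M K Fo \<Gamma> g m0 w =
          (C0h ** matrix_inv Mh ** Q ** matrix_inv (L w) ** R ** diag_inv_sqrt \<Gamma>) *v g
          + (post_cov M K Fo \<Gamma> w ** matrix_inv C0) *v m0"
        using mean01[OF conjunct1[OF a], of g m0] unfolding conjunct2[OF a] .
    qed
    show "post_cov M K Fo \<Gamma> w =
        C0h ** matrix_inv Mh
          ** (mat 1 - Q ** transpose Q + Q ** matrix_inv (L w) ** transpose Q) ** Mh ** C0h"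
      unfolding cov(2) N(2) X assms(12) ..
    show "\<J> w = trace (matrix_inv (transpose F ** BDiag w ** F + mat 1) ** Mh ** C0 ** matrix_inv Mh)"
      using obj(1) by (simp only: assms(17) assms(13) matrix_mul_assoc)
    show "\<J> w = trace C0 - trace C + trace (matrix_inv (L w) ** C)"
      unfolding X by (rule J[OF w])
    show "GDERIV \<J> w :>
        block_sum (\<chi> p. - (norm ((Ch ** matrix_inv (L w) ** R) *v axis p 1))\<^sup>2)"
      unfolding X norm_eq[OF w] by (rule grad[OF w])
    show "has_hessian \<J>
        (\<Sum>k\<in>UNIV. \<Sum>l\<in>UNIV.
          2 *\<^sub>R ((transpose (slice R k) ** matrix_inv (L w) ** C ** matrix_inv (L w) ** slice R l)
                 \<odot> (transpose (slice R k) ** matrix_inv (L w) ** slice R l))) w"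
      unfolding X by (rule hess[OF w])
  qed
qed

end
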